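(* Let $k\in\mathbb{R}$, let $\widetilde\rho>0$, and suppose the constant $C$ satisfies $C>0$, $1-kC>0$ and $$V_\Omega\int_{\mathbb{R}^n}\frac{C\exp\{-|v|^2/2\}}{1-kC\exp\{-|v|^2/2\}}\,dv=\widetilde\rho .$$ Then the functional $F$, considered on the functions $f(x,v)$ with $f\ge0$, $1+kf\ge0$ and total density $\int_\Omega\int_{\mathbb{R}^n}f\,dv\,dx=\widetilde\rho$, attains its maximum on the function $$M_k=\frac{C\exp\{-|v|^2/2\}}{1-kC\exp\{-|v|^2/2\}},$$ that is, $$G(f)=F(M_k)-F(f)>0\qquad (f\ne M_k).$$
   Context: $\Omega\subset\mathbb{R}^n$ ($n\ge1$) is a bounded domain of volume $V_\Omega$. Set $\Phi(f)=f\log f$ for $k=0$ and $\Phi(f)=f\log f-\frac1k(1+kf)\log(1+kf)+f$ for $k\ne0$ (with $0\log0=0$). Entropy: $S(f)=-\int_\Omega\int_{\mathbb{R}^n}\Phi(f)\,dv\,dx$. Total energy: $E(f)=\int_\Omega\int_{\mathbb{R}^n}\frac{|v|^2}{2}f\,dv\,dx$. Free energy: $F(f)=S(f)-E(f)=\int_\Omega\int_{\mathbb{R}^n}\big(-\frac{|v|^2}{2}f-\Phi(f)\big)dv\,dx$. The functions $f$ are measurable functions on $\Omega\times\mathbb{R}^n$ (time being fixed) for which $S(f)$ and $E(f)$ are well defined and finite; $f\ne M_k$ means that $f$ and $M_k$ do not coincide almost everywhere. *)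

theory Defs
  imports "HOL-Analysis.Analysis"
begin

text \<open>
  Lebesgue measure on the phase space \<open>\<Omega> \<times> \<real>\<^sup>n\<close>. The double integrals over
  \<open>x \<in> \<Omega>\<close> and \<open>v \<in> \<real>\<^sup>n\<close> are read as Lebesgue integrals with respect to it.
\<close>

definition phase :: "(real^'n) set \<Rightarrow> ((real^'n) \<times> (real^'n)) measure" where
  "phase \<Omega> = lebesgue_on (\<Omega> \<times> UNIV)"

text \<open>The convention \<open>0 log 0 = 0\<close> holds automatically, since \<open>0 * ln 0 = 0\<close>.\<close>

definition Phi :: "real \<Rightarrow> real \<Rightarrow> real" where
  "Phi k y = (if k = 0 then y * ln y
              else y * ln y - 1 / k * (1 + k * y) * ln (1 + k * y) + y)"

definition entropy :: "real \<Rightarrow> (real^'n) set \<Rightarrow> ((real^'n) \<times> (real^'n) \<Rightarrow> real) \<Rightarrow> real" where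
  "entropy k \<Omega> f = - (\<integral>(x, v). Phi k (f (x, v)) \<partial>phase \<Omega>)"

definition energy :: "(real^'n) set \<Rightarrow> ((real^'n) \<times> (real^'n) \<Rightarrow> real) \<Rightarrow> real" where
  "energy \<Omega> f = (\<integral>(x, v). (norm v)\<^sup>2 / 2 * f (x, v) \<partial>phase \<Omega>)"

definition free_energy :: "real \<Rightarrow> (real^'n) set \<Rightarrow> ((real^'n) \<times> (real^'n) \<Rightarrow> real) \<Rightarrow> real" where
  "free_energy k \<Omega> f = entropy k \<Omega> f - energy \<Omega> f"

text \<open>
  The competitors with total density \<open>\<rho>\<close>. The integrability conditions say that
  entropy, energy and density are well defined and finite; without them the
  Bochner integral would silently be \<open>0\<close>. Values of \<open>f\<close> outside
  \<open>\<Omega> \<times> \<real>\<^sup>n\<close> are irrelevant.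
\<close>

definition admissible ::
    "real \<Rightarrow> (real^'n) set \<Rightarrow> real \<Rightarrow> ((real^'n) \<times> (real^'n) \<Rightarrow> real) set" where
  "admissible k \<Omega> \<rho> = {f.
     f \<in> borel_measurable (phase \<Omega>) \<and>
     (\<forall>x\<in>\<Omega>. \<forall>v. 0 \<le> f (x, v) \<and> 0 \<le> 1 + k * f (x, v)) \<and>
     integrable (phase \<Omega>) (\<lambda>(x, v). Phi k (f (x, v))) \<and>
     integrable (phase \<Omega>) (\<lambda>(x, v). (norm v)\<^sup>2 / 2 * f (x, v)) \<and>
     integrable (phase \<Omega>) f \<and>
     (\<integral>(x, v). f (x, v) \<partial>phase \<Omega>) = \<rho>}"

definition maxwellian :: "real \<Rightarrow> real \<Rightarrow> (real^'n) \<times> (real^'n) \<Rightarrow> real" where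
  "maxwellian k C = (\<lambda>(x, v).
     C * exp (- (norm v)\<^sup>2 / 2) / (1 - k * C * exp (- (norm v)\<^sup>2 / 2)))"

end

theory Submission
  imports Defs
begin

text \<open>
  Where \<open>f > 0\<close> and \<open>1 + k * f > 0\<close>, the entropy density \<open>Phi k\<close> has derivative
  \<open>ln (f / (1 + k * f)) + 1\<close>, and it is strictly convex. The Maxwellian \<open>M\<close> satisfies
  \<open>M / (1 + k * M) = C * exp (- |v|\<^sup>2 / 2)\<close>, so its slope \<open>ln C + 1 - |v|\<^sup>2 / 2\<close> is a
  constant minus the kinetic energy: \<open>M\<close> is a critical point of the free energy under the
  density constraint. Hence, for an admissible \<open>f\<close>, the integral of the Bregman remainder
  \<open>Phi k f - Phi k M - (ln C + 1 - |v|\<^sup>2 / 2) * (f - M)\<close> is exactly the gap between the free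
  energies of \<open>M\<close> and \<open>f\<close>, the constant dropping out because the two densities agree. The
  remainder is nonnegative and vanishes only where \<open>f = M\<close> (\<open>relative_Phi_nonneg_strict\<close>).
  This gives both the maximality and its strictness.

  The remainder is handled without differentiation, so that the boundary values \<open>f = 0\<close> and
  \<open>1 + k * f = 0\<close> need no separate limit: it is a combination of terms
  \<open>a * ln (a / b)\<close>, each estimated by \<open>a * ln (a / b) \<ge> a - b\<close>, with
  equality only for \<open>a = b\<close>.

  It remains to see that \<open>M\<close> itself is admissible. Its density, energy and entropy
  integrands depend on \<open>v\<close> only and are bounded by sums of
  constant multiples of \<open>exp (- |v|\<^sup>2 / 2)\<close> and \<open>|v|\<^sup>2 * exp (- |v|\<^sup>2 / 2)\<close>. That the Gaussian
  is integrable follows from the normalization of \<open>C\<close>, which forces \<open>M\<close> to have a nonzero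
  integral. Fubini's theorem carries integrability in \<open>v\<close> over to the phase space of a bounded
  domain (\<open>has_bochner_integral_phase_velocity\<close>).
\<close>

section \<open>Strict convexity of the entropy density\<close>

lemma mult_ln_divide_ge:
  fixes a b :: real
  assumes "0 \<le> a" "0 < b"
  shows "a - b \<le> a * ln (a / b)"
proof (cases "a = 0")
  case False
  with assms have "a > 0" by simp
  have "ln (b / a) \<le> b / a - 1" using \<open>a > 0\<close> assms by (intro ln_le_minus_one) auto
  then have "a * ln (b / a) \<le> a * (b / a - 1)" using \<open>a > 0\<close> by (intro mult_left_mono) auto
  then show ?thesis using \<open>a > 0\<close> assms by (simp add: ln_div algebra_simps)
qed (use assms in simp)

lemma mult_ln_divide_eq_imp:
  fixes a b :: real
  assumes "0 \<le> a" "0 < b" "a * ln (a / b) = a - b"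
  shows "a = b"
proof (cases "a = 0")
  case False
  with assms have "a > 0" by simp
  have "a * ln (b / a) = a * (b / a - 1)"
    using \<open>a > 0\<close> assms by (simp add: ln_div algebra_simps)
  then have "ln (b / a) = b / a - 1" using \<open>a > 0\<close> by (simp only: mult_cancel_left) simp
  then have "b / a = 1" using \<open>a > 0\<close> assms by (intro ln_eq_minus_one) auto
  then show ?thesis using \<open>a > 0\<close> by simp
qed (use assms in simp)

text \<open>
  The Bregman remainder of \<open>Phi k\<close>: the amount by which \<open>Phi k y\<close> exceeds the tangent at \<open>m\<close>,
  with the derivative of \<open>Phi k\<close> at \<open>m\<close> written out.
\<close>

definition relative_Phi :: "real \<Rightarrow> real \<Rightarrow> real \<Rightarrow> real" where
  "relative_Phi k y m = Phi k y - Phi k m - (ln (m / (1 + k * m)) + 1) * (y - m)"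

lemma relative_Phi_zero:
  assumes "0 \<le> y" "0 < m"
  shows "relative_Phi 0 y m = y * ln (y / m) - (y - m)"
  using assms by (cases "y = 0") (simp_all add: relative_Phi_def Phi_def ln_div algebra_simps)

lemma relative_Phi_nonzero:
  assumes "k \<noteq> 0" "0 \<le> y" "0 \<le> 1 + k * y" "0 < m" "0 < 1 + k * m"
  shows "relative_Phi k y m =
           y * ln (y / m) - (1 + k * y) * ln ((1 + k * y) / (1 + k * m)) / k"
proof -
  have 1: "y * ln (y / m) = y * ln y - y * ln m"
    using assms by (cases "y = 0") (simp_all add: ln_div algebra_simps)
  have 2: "(1 + k * y) * ln ((1 + k * y) / (1 + k * m)) =
           (1 + k * y) * ln (1 + k * y) - (1 + k * y) * ln (1 + k * m)"
    using assms by (cases "1 + k * y = 0") (simp_all add: ln_div right_diff_distrib)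
  have 3: "ln (m / (1 + k * m)) = ln m - ln (1 + k * m)"
    using assms by (simp add: ln_div)
  show ?thesis
    unfolding relative_Phi_def Phi_def 1 2 3 using assms(1) by (simp add: field_simps)
qed

text \<open>
  Strict convexity of \<open>Phi k\<close> in tangent form. For \<open>k < 0\<close> the two terms of
  \<open>relative_Phi_nonzero\<close> are estimated separately. For \<open>k > 0\<close> the second one enters with a
  negative coefficient, and the claim is the log-sum inequality for the pairs \<open>(y, m)\<close> and \<open>(1 / k, 1 / k)\<close>.
\<close>

lemma relative_Phi_nonneg_strict:
  assumes "0 \<le> y" "0 \<le> 1 + k * y" "0 < m" "0 < 1 + k * m"
  shows "0 \<le> relative_Phi k y m \<and> (relative_Phi k y m = 0 \<longrightarrow> y = m)"
proof -
  consider "k = 0" | "k < 0" | "k > 0" by linarith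
  then show ?thesis
  proof cases
    case 1
    then show ?thesis
      using relative_Phi_zero mult_ln_divide_ge[of y m] mult_ln_divide_eq_imp[of y m] assms by auto
  next
    case 2
    define A where "A = y * ln (y / m) - (y - m)"
    define B where "B = (1 + k * y) * ln ((1 + k * y) / (1 + k * m)) - k * (y - m)"
    have "relative_Phi k y m = A - B / k"
      using relative_Phi_nonzero[of k y m] assms 2 by (simp add: A_def B_def field_simps)
    moreover have "0 \<le> A" using mult_ln_divide_ge[of y m] assms by (simp add: A_def)
    moreover have "0 \<le> B"
      using mult_ln_divide_ge[of "1 + k * y" "1 + k * m"] assms by (simp add: B_def algebra_simps)
    then have "B / k \<le> 0" using 2 by (simp add: divide_nonneg_neg)
    moreover have "y = m" if "A = 0"
      using mult_ln_divide_eq_imp[of y m] assms that by (simp add: A_def)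
    ultimately show ?thesis by auto
  next
    case 3
    have "1 + k * y > 0" using 3 assms by (simp add: add_pos_nonneg)
    \<comment> \<open>The ratio of the two sums; rescaling by it makes the linear terms cancel.\<close>
    define r where "r = (1 + k * y) / (1 + k * m)"
    have "r > 0" unfolding r_def using \<open>1 + k * y > 0\<close> assms by simp
    define A where "A = y * ln (y / (m * r)) - (y - m * r)"
    define B where "B = 1 * ln (1 / r) - (1 - r)"
    have *: "y * ln (y / (m * r)) = y * ln (y / m) - y * ln r"
      using \<open>r > 0\<close> assms by (cases "y = 0") (simp_all add: ln_div ln_mult algebra_simps)
    have **: "r * (1 + k * m) = 1 + k * y" using assms by (simp add: r_def)
    have "A + B / k = y * ln (y / m) - (1 + k * y) * ln r / k"
      unfolding A_def B_def * using ** \<open>r > 0\<close> 3 by (simp add: ln_div field_simps)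
    then have "relative_Phi k y m = A + B / k"
      using relative_Phi_nonzero[of k y m] assms 3 by (simp add: r_def)
    moreover have "0 \<le> A" using mult_ln_divide_ge[of y "m * r"] assms \<open>r > 0\<close> by (simp add: A_def)
    moreover have "0 \<le> B" using mult_ln_divide_ge[of 1 r] \<open>r > 0\<close> by (simp add: B_def)
    moreover have "y = m * r" if "A = 0"
      using mult_ln_divide_eq_imp[of y "m * r"] assms that \<open>r > 0\<close> by (simp add: A_def)
    moreover have "r = 1" if "B = 0"
      using mult_ln_divide_eq_imp[of 1 r] that \<open>r > 0\<close> by (simp add: B_def)
    ultimately show ?thesis using 3
      by (auto simp: add_nonneg_eq_0_iff)
  qed
qed

section \<open>Integration over phase space\<close>

lemma has_bochner_integral_phase_velocity:
  fixes \<Omega> :: "(real^'n) set" and g :: "real^'n \<Rightarrow> real"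
  assumes "open \<Omega>" "bounded \<Omega>" and g: "integrable lborel g"
  shows "has_bochner_integral (phase \<Omega>) (\<lambda>(x, v). g v) (measure lborel \<Omega> * (\<integral>v. g v \<partial>lborel))"
proof -
  have [measurable]: "\<Omega> \<in> sets borel" "g \<in> borel_measurable borel"
    using assms by auto
  define h :: "(real^'n) \<times> (real^'n) \<Rightarrow> real" where "h = (\<lambda>(x, v). indicator \<Omega> x * g v)"
  have fin: "integrable lborel (indicator \<Omega> :: real^'n \<Rightarrow> real)"
    using assms emeasure_bounded_finite[of \<Omega>] by (simp add: integrable_indicator_iff)
  have meas: "h \<in> borel_measurable (lborel \<Otimes>\<^sub>M lborel)"
    unfolding h_def by measurable
  have int: "integrable (lborel \<Otimes>\<^sub>M lborel) h"
  proof (rule lborel_pair.Fubini_integrable[OF meas])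
    show "integrable lborel (\<lambda>x. \<integral>y. norm (h (x, y)) \<partial>lborel)"
      using fin by (simp add: h_def abs_mult)
    show "AE x in lborel. integrable lborel (\<lambda>y. h (x, y))"
      using g by (simp add: h_def)
  qed
  have "(\<integral>p. h p \<partial>(lborel \<Otimes>\<^sub>M lborel)) = measure lborel \<Omega> * (\<integral>v. g v \<partial>lborel)"
    using lborel_pair.integral_fst'[OF int] by (simp add: h_def)
  with int have "has_bochner_integral lborel h (measure lborel \<Omega> * (\<integral>v. g v \<partial>lborel))"
    by (simp add: has_bochner_integral_iff lborel_prod)
  moreover have "h \<in> borel_measurable lborel" using meas by (simp add: lborel_prod)
  ultimately have "has_bochner_integral lebesgue h (measure lborel \<Omega> * (\<integral>v. g v \<partial>lborel))"
    by (simp add: has_bochner_integral_iff integrable_completion integral_completion)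
  moreover have "(\<lambda>p. indicator (\<Omega> \<times> UNIV) p *\<^sub>R (case p of (x, v) \<Rightarrow> g v)) = h"
    by (auto simp: h_def fun_eq_iff indicator_def)
  moreover have "\<Omega> \<times> (UNIV :: (real^'n) set) \<in> sets lebesgue"
    using assms by (intro sets_completionI_sets) (auto intro: borel_open open_Times)
  ultimately show ?thesis
    by (simp add: phase_def has_bochner_integral_iff integrable_restrict_space
        integral_restrict_space)
qed

lemma integrable_lborel_scaleR:
  fixes g :: "'a::euclidean_space \<Rightarrow> real"
  assumes "c \<noteq> 0" "integrable lborel g"
  shows "integrable lborel (\<lambda>x. g (c *\<^sub>R x))"
proof -
  have [measurable]: "g \<in> borel_measurable borel" using assms by auto
  have "integrable (density (distr lborel borel (\<lambda>x. 0 + c *\<^sub>R x)) (\<lambda>_. ennreal (\<bar>c\<bar> ^ DIM('a)))) g"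
    using assms lborel_affine[OF assms(1), of "0::'a"] by simp
  then show ?thesis
    using assms(1) by (subst (asm) integrable_density) (auto simp: integrable_distr_eq)
qed

lemma integrable_gaussian_second_moment:
  assumes "integrable lborel (\<lambda>v::'a::euclidean_space. exp (- (norm v)\<^sup>2 / 2))"
  shows "integrable lborel (\<lambda>v::'a. (norm v)\<^sup>2 * exp (- (norm v)\<^sup>2 / 2))"
proof (rule Bochner_Integration.integrable_bound)
  \<comment> \<open>The dominating function is a wider Gaussian, obtained by dilation.\<close>
  have "integrable lborel (\<lambda>v::'a. exp (- (norm ((1 / sqrt 2) *\<^sub>R v))\<^sup>2 / 2))"
    using assms by (intro integrable_lborel_scaleR) auto
  then show "integrable lborel (\<lambda>v::'a. 4 * exp (- (norm v)\<^sup>2 / 4))"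
    by (simp add: power_divide)
  have "norm (s * exp (- s / 2)) \<le> norm (4 * exp (- s / 4))" if "s \<ge> 0" for s :: real
  proof -
    have "s / 4 \<le> exp (s / 4)" using exp_ge_add_one_self[of "s / 4"] by linarith
    then have "s * exp (- s / 2) \<le> 4 * exp (s / 4) * exp (- s / 2)"
      by (intro mult_right_mono) auto
    also have "\<dots> = 4 * exp (- s / 4)" by (simp add: mult.assoc flip: exp_add)
    finally show ?thesis using that by simp
  qed
  then show "AE v::'a in lborel. norm ((norm v)\<^sup>2 * exp (- (norm v)\<^sup>2 / 2))
                 \<le> norm (4 * exp (- (norm v)\<^sup>2 / 4))"
    by simp
qed measurable

section \<open>The equilibrium profile\<close>

text \<open>
  Here \<open>e\<close> stands for the value \<open>C * exp (- |v|\<^sup>2 / 2)\<close>. For \<open>k \<noteq> 0\<close> all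
  occurrences of \<open>ln (1 - k * e)\<close> combine into \<open>ln (1 - k * e) / k\<close>, which is of the order
  of \<open>e\<close>.
\<close>

lemma Phi_equilibrium:
  assumes "0 < e" "0 < 1 - k * e"
  shows "Phi k (e / (1 - k * e)) =
           e / (1 - k * e) * ln e + (if k = 0 then 0 else ln (1 - k * e) / k + e / (1 - k * e))"
proof (cases "k = 0")
  case False
  define D where "D = 1 - k * e"
  have "D > 0" using assms by (simp add: D_def)
  have 1: "1 + k * (e / D) = 1 / D" using \<open>D > 0\<close> by (simp add: D_def field_simps)
  have 2: "e = (1 - D) / k" using False by (simp add: D_def)
  have "Phi k (e / D) = e / D * (ln e - ln D) + 1 / k * (1 / D) * ln D + e / D"
    unfolding Phi_def 1 using False \<open>D > 0\<close> assms(1) by (simp add: ln_div)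
  also have "\<dots> = e / D * ln e + ((1 / k - e) / D) * ln D + e / D"
    using \<open>D > 0\<close> by (simp add: diff_divide_distrib algebra_simps)
  also have "(1 / k - e) / D = 1 / k"
    using False \<open>D > 0\<close> by (simp add: 2 field_simps)
  finally show ?thesis using False by (simp add: D_def)
qed (simp add: Phi_def)

lemma abs_Phi_equilibrium_le:
  assumes "0 < e" "0 < d" "d \<le> 1" "d \<le> 1 - k * e"
  shows "\<bar>Phi k (e / (1 - k * e))\<bar> \<le> e / d * (\<bar>ln e\<bar> + 2)"
proof -
  define D where "D = 1 - k * e"
  have D: "D > 0" "d \<le> D" using assms by (auto simp: D_def)
  have M: "0 \<le> e / D" "e / D \<le> e / d" using D assms by (auto intro: divide_left_mono)
  have E: "e \<le> e / d" using assms by (simp add: field_simps)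
  have "\<bar>e / D * ln e\<bar> \<le> e / d * \<bar>ln e\<bar>"
    using M unfolding abs_mult by (intro mult_right_mono) auto
  moreover have "\<bar>ln D / k\<bar> \<le> e / d" if "k \<noteq> 0"
  proof -
    have "ln D \<le> - (k * e)" using ln_le_minus_one[OF D(1)] by (simp add: D_def)
    moreover have "- ln D \<le> k * (e / D)"
      using ln_le_minus_one[of "1 / D"] D by (simp add: ln_div D_def field_simps)
    moreover have "- (k * e) \<le> \<bar>k\<bar> * (e / d)"
    proof -
      have "- (k * e) \<le> \<bar>k\<bar> * e" using assms(1) abs_ge_minus_self[of "k * e"] by (simp add: abs_mult)
      also have "\<dots> \<le> \<bar>k\<bar> * (e / d)" using E by (intro mult_left_mono) auto
      finally show ?thesis .
    qed
    moreover have "k * (e / D) \<le> \<bar>k\<bar> * (e / d)" using M by (intro mult_mono) auto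
    ultimately have "\<bar>ln D\<bar> \<le> \<bar>k\<bar> * (e / d)" by linarith
    then show ?thesis using that by (simp add: field_simps)
  qed
  ultimately have *: "\<bar>e / D * ln e\<bar> \<le> e / d * \<bar>ln e\<bar>" "k \<noteq> 0 \<Longrightarrow> \<bar>ln D / k\<bar> \<le> e / d"
    by auto
  have "\<bar>Phi k (e / D)\<bar> \<le> e / d * \<bar>ln e\<bar> + 2 * (e / d)"
  proof (cases "k = 0")
    case True
    then have "\<bar>Phi k (e / D)\<bar> = \<bar>e / D * ln e\<bar>"
      using Phi_equilibrium[of e k] assms(1) D(1) unfolding D_def[symmetric] by simp
    then show ?thesis using *(1) M by linarith
  next
    case False
    then have "Phi k (e / D) = e / D * ln e + (ln D / k + e / D)"
      using Phi_equilibrium[of e k] assms(1) D(1) unfolding D_def[symmetric] by simp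
    moreover have "\<bar>e / D\<bar> \<le> e / d" using M by simp
    ultimately show ?thesis
      using abs_triangle_ineq[of "e / D * ln e" "ln D / k + e / D"]
        abs_triangle_ineq[of "ln D / k" "e / D"] *(1) *(2)[OF False] by simp
  qed
  then show ?thesis by (simp add: D_def algebra_simps)
qed

section \<open>Maximality of the Maxwellian\<close>

theorem proposition2p1:
  fixes \<Omega> :: "(real^'n) set" and k C \<rho> :: real
  assumes "open \<Omega>" and "connected \<Omega>" and "\<Omega> \<noteq> {}" and "bounded \<Omega>"
    and "\<rho> > 0"
    and "C > 0" and "1 - k * C > 0"
    and "measure lebesgue \<Omega> *
           (\<integral>v. C * exp (- (norm v)\<^sup>2 / 2) / (1 - k * C * exp (- (norm v)\<^sup>2 / 2))
              \<partial>(lebesgue :: (real^'n) measure)) = \<rho>"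
  shows "maxwellian k C \<in> admissible k \<Omega> \<rho> \<and>
         (\<forall>f \<in> admissible k \<Omega> \<rho>.
            free_energy k \<Omega> f \<le> free_energy k \<Omega> (maxwellian k C)) \<and>
         (\<forall>f \<in> admissible k \<Omega> \<rho>.
            \<not> (AE p in phase \<Omega>. f p = maxwellian k C p) \<longrightarrow>
            free_energy k \<Omega> (maxwellian k C) - free_energy k \<Omega> f > 0)"
proof -
  define e :: "real^'n \<Rightarrow> real" where "e v = C * exp (- (norm v)\<^sup>2 / 2)" for v
  define m :: "real^'n \<Rightarrow> real" where "m v = e v / (1 - k * e v)" for v
  \<comment> \<open>A lower bound for \<open>1 - k * t\<close> over \<open>0 \<le> t \<le> C\<close>, valid for either sign of \<open>k\<close>.\<close>
  define d where "d = min 1 (1 - k * C)"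
  let ?M = "maxwellian k C :: (real^'n) \<times> (real^'n) \<Rightarrow> real"
  have M_eq: "?M = (\<lambda>(x, v). m v)"
    by (simp add: maxwellian_def m_def e_def mult.assoc)
  have d: "0 < d" "d \<le> 1" using assms by (auto simp: d_def)
  have e_pos: "0 < e v" for v using assms by (simp add: e_def)
  have e_le: "e v \<le> C" for v using assms by (simp add: e_def)
  have d_le: "d \<le> 1 - k * e v" for v
  proof (cases "k \<ge> 0")
    case True
    then show ?thesis using mult_left_mono[OF e_le[of v] True] by (simp add: d_def)
  next
    case False
    then show ?thesis using mult_nonpos_nonneg[of k "e v"] e_pos[of v] by (simp add: d_def)
  qed
  have D_pos: "0 < 1 - k * e v" for v using d(1) d_le[of v] by linarith
  have m_pos: "0 < m v" for v using e_pos D_pos by (simp add: m_def)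
  have one_plus: "1 + k * m v = 1 / (1 - k * e v)" for v
    using D_pos[of v] by (simp add: m_def field_simps)
  have one_plus_pos: "0 < 1 + k * m v" for v using D_pos by (simp add: one_plus)
  have ln_e: "ln (e v) = ln C - (norm v)\<^sup>2 / 2" for v
    using assms by (simp add: e_def ln_mult)
  have slope: "ln (m v / (1 + k * m v)) = ln C - (norm v)\<^sup>2 / 2" for v
    unfolding one_plus ln_e[symmetric] unfolding m_def using D_pos[of v] by simp
  have e_meas [measurable]: "e \<in> borel_measurable borel" unfolding e_def by measurable
  have m_meas [measurable]: "m \<in> borel_measurable borel" unfolding m_def by measurable

  have vol: "measure lborel \<Omega> * (\<integral>v. m v \<partial>lborel) = \<rho>"
    using assms(1,8) by (simp add: m_def e_def mult.assoc integral_completion)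
  \<comment> \<open>The integral of a nonintegrable function is \<open>0\<close> by convention, but \<open>\<rho> > 0\<close>.\<close>
  then have m_int: "integrable lborel m"
    using \<open>\<rho> > 0\<close> not_integrable_integral_eq[of lborel m] by fastforce
  \<comment> \<open>Up to a constant factor, \<open>m\<close> bounds the Gaussian, whose integrability is thus inherited.\<close>
  have e_int: "integrable lborel e"
  proof (rule Bochner_Integration.integrable_bound)
    show "integrable lborel (\<lambda>v. (1 + \<bar>k * C\<bar>) * m v)" using m_int by simp
    have "e v \<le> (1 + \<bar>k * C\<bar>) * m v" for v
    proof -
      have "\<bar>k * e v\<bar> \<le> \<bar>k * C\<bar>"
        using e_le[of v] e_pos[of v] assms(6) by (simp add: abs_mult mult_left_mono)
      then have "1 - k * e v \<le> 1 + \<bar>k * C\<bar>" by linarith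
      then have "(1 - k * e v) * m v \<le> (1 + \<bar>k * C\<bar>) * m v"
        using m_pos[of v] by (intro mult_right_mono) auto
      then show ?thesis using D_pos[of v] by (simp add: m_def)
    qed
    then show "AE v in lborel. norm (e v) \<le> norm ((1 + \<bar>k * C\<bar>) * m v)"
      using e_pos m_pos by (auto simp: abs_mult less_imp_le)
  qed simp
  have ve_int: "integrable lborel (\<lambda>v. (norm v)\<^sup>2 * e v)"
  proof -
    have "integrable lborel (\<lambda>v::real^'n. exp (- (norm v)\<^sup>2 / 2))"
      using integrable_mult_right[OF e_int, of "1 / C"] assms(6) by (simp add: e_def)
    from integrable_mult_right[OF integrable_gaussian_second_moment[OF this], of C]
    show ?thesis by (simp add: e_def mult_ac)
  qed
  have m_le: "m v \<le> e v / d" for v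
    using d d_le[of v] e_pos[of v] unfolding m_def by (intro divide_left_mono) auto
  have vm_int: "integrable lborel (\<lambda>v. (norm v)\<^sup>2 / 2 * m v)"
  proof (rule Bochner_Integration.integrable_bound)
    show "integrable lborel (\<lambda>v. (norm v)\<^sup>2 * e v * (1 / (2 * d)))" using ve_int by simp
    have "(norm v)\<^sup>2 / 2 * m v \<le> (norm v)\<^sup>2 * e v * (1 / (2 * d))" for v
      using mult_left_mono[OF m_le[of v], of "(norm v)\<^sup>2 / 2"] by (simp add: field_simps)
    then show "AE v in lborel. norm ((norm v)\<^sup>2 / 2 * m v)
                 \<le> norm ((norm v)\<^sup>2 * e v * (1 / (2 * d)))"
      using m_pos e_pos d by (auto simp: abs_mult less_imp_le)
  qed measurable
  have Phi_int: "integrable lborel (\<lambda>v. Phi k (m v))"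
  proof (rule Bochner_Integration.integrable_bound)
    let ?w = "\<lambda>v. (\<bar>ln C\<bar> + 2) / d * e v + 1 / (2 * d) * ((norm v)\<^sup>2 * e v)"
    show "integrable lborel ?w" using e_int ve_int by simp
    have "\<bar>Phi k (m v)\<bar> \<le> ?w v" for v
    proof -
      have "\<bar>Phi k (m v)\<bar> \<le> e v / d * (\<bar>ln (e v)\<bar> + 2)"
        unfolding m_def using e_pos d d_le by (intro abs_Phi_equilibrium_le) auto
      also have "\<dots> \<le> e v / d * (\<bar>ln C\<bar> + (norm v)\<^sup>2 / 2 + 2)"
        using e_pos[of v] d(1) abs_triangle_ineq4[of "ln C" "(norm v)\<^sup>2 / 2"]
        by (intro mult_left_mono) (auto simp: ln_e)
      also have "\<dots> = ?w v" using d by (simp add: field_simps)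
      finally show ?thesis .
    qed
    then show "AE v in lborel. norm (Phi k (m v)) \<le> norm (?w v)"
      by (auto intro: order_trans[OF _ abs_ge_self])
    show "(\<lambda>v. Phi k (m v)) \<in> borel_measurable lborel" unfolding Phi_def by measurable
  qed

  note phase = has_bochner_integral_phase_velocity[OF assms(1,4)]
  have adm: "?M \<in> admissible k \<Omega> \<rho>"
    using phase[OF m_int] phase[OF vm_int] phase[OF Phi_int] m_pos one_plus_pos vol
    by (auto simp: admissible_def M_eq has_bochner_integral_iff less_imp_le split_beta')

  have gap: "free_energy k \<Omega> f \<le> free_energy k \<Omega> ?M \<and>
      (free_energy k \<Omega> f = free_energy k \<Omega> ?M \<longrightarrow> (AE p in phase \<Omega>. f p = ?M p))"
    if f: "f \<in> admissible k \<Omega> \<rho>" for f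
  proof -
    have fi: "integrable (phase \<Omega>) (\<lambda>p. Phi k (f p))"
        "integrable (phase \<Omega>) (\<lambda>p. (norm (snd p))\<^sup>2 / 2 * f p)"
        "integrable (phase \<Omega>) f" "(\<integral>p. f p \<partial>phase \<Omega>) = \<rho>"
      using f by (simp_all add: admissible_def split_beta')
    have Mi: "integrable (phase \<Omega>) (\<lambda>p. Phi k (?M p))"
        "integrable (phase \<Omega>) (\<lambda>p. (norm (snd p))\<^sup>2 / 2 * ?M p)"
        "integrable (phase \<Omega>) ?M" "(\<integral>p. ?M p \<partial>phase \<Omega>) = \<rho>"
      using adm by (simp_all add: admissible_def split_beta')
    let ?g = "\<lambda>p. relative_Phi k (f p) (?M p)"
    \<comment> \<open>The tangent term is affine in \<open>|v|\<^sup>2\<close>, so it integrates to densities and energies.\<close>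
    have g_eq: "?g = (\<lambda>p. Phi k (f p) - Phi k (?M p) - (ln C + 1) * (f p - ?M p)
        + ((norm (snd p))\<^sup>2 / 2 * f p - (norm (snd p))\<^sup>2 / 2 * ?M p))"
      by (auto simp: fun_eq_iff relative_Phi_def M_eq slope algebra_simps)
    have g_int: "integrable (phase \<Omega>) ?g" unfolding g_eq using fi Mi by simp
    have "(\<integral>p. ?g p \<partial>phase \<Omega>) = free_energy k \<Omega> ?M - free_energy k \<Omega> f"
      unfolding g_eq using fi Mi
      by (simp add: free_energy_def entropy_def energy_def split_beta')
    moreover have pos: "0 \<le> ?g p \<and> (?g p = 0 \<longrightarrow> f p = ?M p)" if "p \<in> space (phase \<Omega>)" for p
    proof -
      obtain x v where p: "p = (x, v)" "x \<in> \<Omega>"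
        using \<open>p \<in> space (phase \<Omega>)\<close> by (auto simp: phase_def space_restrict_space)
      then have "0 \<le> f p" "0 \<le> 1 + k * f p" using f by (auto simp: admissible_def)
      then show ?thesis
        using relative_Phi_nonneg_strict[of "f p" k "?M p"] m_pos one_plus_pos p by (simp add: M_eq)
    qed
    moreover have "0 \<le> (\<integral>p. ?g p \<partial>phase \<Omega>)"
      using pos by (intro Bochner_Integration.integral_nonneg) auto
    moreover have "AE p in phase \<Omega>. f p = ?M p" if "(\<integral>p. ?g p \<partial>phase \<Omega>) = 0"
    proof -
      have "AE p in phase \<Omega>. ?g p = 0"
        using that integral_nonneg_eq_0_iff_AE[OF g_int] pos by (auto intro: AE_I2)
      then show ?thesis using AE_space by eventually_elim (use pos in blast)
    qed
    ultimately show ?thesis by auto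
  qed
  show ?thesis using adm gap by (auto simp: less_le)
qed

end
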